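(* Let $\Omega\subset\mathbb{R}^n$ be an open set with $\partial\Omega\neq\emptyset$, let $x\in\Omega$, and let $\gamma:[0,\infty)\to\Omega$ be the unique Lipschitz continuous arc such that $$\gamma'(t)\in D^+d_{\partial\Omega}(\gamma(t))\quad\text{for a.e. } t\in[0,\infty),\qquad \gamma(0)=x.$$ If $\gamma(t_0)\in\Sigma(d_{\partial\Omega})$ for some $t_0\ge 0$, then $\gamma(t)\in\Sigma(d_{\partial\Omega})$ for all $t\in[t_0,+\infty)$.
   Context: $|\cdot|$ and $\langle\cdot,\cdot\rangle$ are the Euclidean norm and scalar product. For a nonempty closed set $C\subset\mathbb{R}^n$, $d_C(x)=\min_{y\in C}|y-x|$. The (Fréchet) superdifferential of a function $u:\Omega\to\mathbb{R}$ at $x\in\Omega$ is $$D^+u(x)=\Big\{p\in\mathbb{R}^n:\ \limsup_{y\to x}\frac{u(y)-u(x)-\langle p,y-x\rangle}{|y-x|}\le 0\Big\}.$$ $\Sigma(d_{\partial\Omega})$, the singular set, is the set of points of $\Omega$ at which $d_{\partial\Omega}$ is not differentiable. It is known that, for every $x\in\Omega$, the arc $\gamma$ described in the claim exists and is unique. *)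

theory Defs
  imports "HOL-Analysis.Analysis"
begin

(* The quotient is cast to ereal because Limsup lives in a complete lattice; it may be infinite. *)
definition superdifferential :: "('a::real_inner) set \<Rightarrow> ('a \<Rightarrow> real) \<Rightarrow> 'a \<Rightarrow> 'a set" where
  "superdifferential \<Omega> u x =
     {p. Limsup (at x within \<Omega>) (\<lambda>y. ereal ((u y - u x - p \<bullet> (y - x)) / norm (y - x))) \<le> 0}"

(* For nonempty closed C, infdist y C is the distance from y to C, with the infimum attained. *)
definition boundary_dist :: "('a::metric_space) set \<Rightarrow> 'a \<Rightarrow> real" where
  "boundary_dist \<Omega> y = infdist y (frontier \<Omega>)"

definition singular_set :: "('a::real_normed_vector) set \<Rightarrow> 'a set" where
  "singular_set \<Omega> = {x \<in> \<Omega>. \<not> boundary_dist \<Omega> differentiable (at x)}"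

end

theory Submission
  imports Defs
begin

text \<open>
  Write \<open>d\<close> for the distance to the boundary. Since \<open>|x|\<^sup>2 - d(x)\<^sup>2\<close> is convex, after the change of time
  \<open>dt = d ds\<close> the arc becomes a flow whose velocity \<open>w\<close> is a supergradient of \<open>d\<^sup>2/2\<close>. Two orbits diverge
  at most like \<open>exp s\<close>, so comparing an orbit with its own time shifts shows that \<open>exp(-s) |w(s)|\<close> is
  nonincreasing. If \<open>d\<close> is differentiable at the point reached at time \<open>s1\<close>, then the speed there is the full
  \<open>d1 = d(\<beta>(s1))\<close>, hence \<open>|w(s)| \<ge> d1 exp(s - s1)\<close> at all earlier times. As \<open>d\<^sup>2\<close> grows at rate \<open>2|w|\<^sup>2\<close> this
  forces \<open>d(\<beta>(s)) \<le> d1 exp(s - s1)\<close>, and as \<open>|w| \<le> d\<close> the displacement is at most the gain in \<open>d\<close>. So the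
  starting point lies inside the segment from the end point to a nearest boundary point, where \<open>d\<close> is
  squeezed between two functions with the same gradient: it was already differentiable there.
\<close>

section \<open>Monotonicity of Lipschitz functions from information almost everywhere\<close>

text \<open>No derivative of \<open>f\<close> is needed: outside \<open>N\<close> the left
  increments of \<open>f\<close> dominate those of a function \<open>k\<close> with nonnegative
  derivative at the point. An open set of measure at most \<open>e\<close> covers \<open>N\<close>;
  on it the Lipschitz bound limits the loss to \<open>L * e\<close>, and elsewhere a slope
  \<open>e\<close> is spent.\<close>

lemma lipschitz_nondecreasing_ae:
  fixes f :: "real \<Rightarrow> real"
  assumes "a \<le> b" and lip: "L-lipschitz_on {a..b} f" and "negligible N"
    and supp: "\<And>t. t \<in> {a<..<b} - N \<Longrightarrow>
      \<exists>k D. (k has_real_derivative D) (at t) \<and> 0 \<le> D \<and> (\<forall>u\<in>{a..<t}. k t - k u \<le> f t - f u)"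
  shows "f a \<le> f b"
proof (cases "a = b")
  case False
  then have ab: "a < b" using assms by simp
  have L0: "0 \<le> L" using lip lipschitz_on_nonneg by blast
  have key: "f a \<le> f b + L * e + e * (b - a)" if e: "0 < e" for e
  proof -
    \<comment> \<open>The hypothesis says nothing at \<open>b\<close>, but the argument must be able
      to step left from every point of \<open>{a<..b}\<close>; so \<open>b\<close> is treated as
      exceptional.\<close>
    have negl: "negligible (insert b N)" using assms by simp
    then have "insert b N \<in> sets lebesgue" by (rule negligible_imp_sets)
    then obtain U where U: "open U" "insert b N \<subseteq> U" "U - insert b N \<in> lmeasurable"
        "emeasure lebesgue (U - insert b N) < ennreal e"
      using sets_lebesgue_outer_open[OF _ e] by blast
    have Um: "U \<in> lmeasurable"
    proof -
      have "insert b N \<in> lmeasurable" using negl negligible_iff_measure by blast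
      then have "(U - insert b N) \<union> insert b N \<in> lmeasurable" using U(3) by (rule fmeasurable.Un[rotated])
      moreover have "(U - insert b N) \<union> insert b N = U" using U by auto
      ultimately show ?thesis by simp
    qed
    have Ue: "measure lebesgue U \<le> e"
    proof -
      have "measure lebesgue U = measure lebesgue (U - insert b N)"
        by (rule measure_negligible_symdiff[OF U(3)])
           (rule negligible_subset[OF negl], auto)
      also have "\<dots> \<le> e"
        using U(4) e by (metis U(3) emeasure_eq_measure2 ennreal_less_iff less_imp_le measure_nonneg)
      finally show ?thesis .
    qed
    define \<psi> where "\<psi> t = measure lebesgue (U \<inter> {a..t})" for t
    have meas: "U \<inter> {a..t} \<in> lmeasurable" for t
      using Um by (intro fmeasurable_Int_fmeasurable) auto
    have mono: "\<psi> u \<le> \<psi> t" if "u \<le> t" for u t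
      unfolding \<psi>_def by (rule measure_mono_fmeasurable) (use that meas in auto)
    have incr: "\<psi> t \<le> \<psi> u + (t - u)" if "u \<le> t" for u t
    proof -
      have "\<psi> t \<le> measure lebesgue ((U \<inter> {a..u}) \<union> {u..t})"
        unfolding \<psi>_def by (rule measure_mono_fmeasurable) (use meas in auto)
      also have "\<dots> \<le> \<psi> u + measure lebesgue {u..t}"
        unfolding \<psi>_def by (rule measure_Un_le) (use meas in auto)
      finally show ?thesis using that by simp
    qed
    have cont\<psi>: "continuous_on {a..b} \<psi>"
    proof -
      have "1-lipschitz_on {a..b} \<psi>"
      proof (rule lipschitz_on_leI)
        fix u t :: real assume "u \<le> t"
        then show "dist (\<psi> u) (\<psi> t) \<le> 1 * dist u t"
          using mono[of u t] incr[of u t] by (simp add: dist_real_def)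
      qed simp
      then show ?thesis by (rule lipschitz_on_continuous_on)
    qed
    \<comment> \<open>On the exceptional set the growth of \<open>\<psi>\<close> compensates for the possible decrease of \<open>f\<close>.\<close>
    define g where "g t = f t + L * \<psi> t + e * (t - a)" for t
    have contg: "continuous_on {a..b} g"
      unfolding g_def by (intro continuous_intros cont\<psi> lipschitz_on_continuous_on[OF lip])
    have step: "\<exists>u\<in>{a..<t}. g u \<le> g t" if t: "t \<in> {a<..b}" for t
    proof (cases "t \<in> insert b N")
      case True
      then have "t \<in> U" using U by auto
      then obtain r where r: "r > 0" "ball t r \<subseteq> U" using U(1) open_contains_ball by blast
      define u where "u = max a (t - r/2)"
      have u: "a \<le> u" "u < t" "t - r < u" using r t by (auto simp: u_def)
      have sub: "{u..t} \<subseteq> U" using u r by (force simp: dist_real_def subset_iff)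
      have "\<psi> u + (t - u) \<le> \<psi> t"
      proof -
        have Ioc: "{u<..t} \<in> lmeasurable" by (rule bounded_set_imp_lmeasurable) auto
        have "\<psi> u + (t - u) = measure lebesgue (U \<inter> {a..u}) + measure lebesgue {u<..t}"
          using u unfolding \<psi>_def by simp
        also have "\<dots> = measure lebesgue ((U \<inter> {a..u}) \<union> {u<..t})"
          by (rule measure_Union[symmetric])
             (use fmeasurableD[OF meas] fmeasurableD2[OF meas] fmeasurableD2[OF Ioc] in auto)
        also have "\<dots> \<le> \<psi> t"
          unfolding \<psi>_def by (rule measure_mono_fmeasurable) (use meas u sub in \<open>auto simp: subset_iff\<close>)
        finally show ?thesis .
      qed
      then have "L * (t - u) \<le> L * (\<psi> t - \<psi> u)"
        using L0 by (intro mult_left_mono) auto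
      moreover have "f u - f t \<le> L * (t - u)"
        using lipschitz_onD[OF lip, of u t] u t by (auto simp: dist_real_def)
      moreover have "e * (u - a) \<le> e * (t - a)" using e u by simp
      ultimately have "g u \<le> g t" unfolding g_def by (simp add: algebra_simps)
      then show ?thesis using u by auto
    next
      case False
      then obtain k D where k: "(k has_real_derivative D) (at t)" "0 \<le> D"
        "\<And>u. u\<in>{a..<t} \<Longrightarrow> k t - k u \<le> f t - f u"
        using supp[of t] t by force
      \<comment> \<open>The slope \<open>e\<close> turns \<open>0 \<le> D\<close> into a positive
        derivative, which gives strictly smaller values just to the left of
        \<open>t\<close>.\<close>
      have "((\<lambda>x. k x + e * x) has_real_derivative D + e) (at t)"
        using k(1) by (auto intro!: derivative_eq_intros)
      then obtain d where d: "d > 0" "\<And>h. h > 0 \<Longrightarrow> h < d \<Longrightarrow> k (t - h) + e * (t - h) < k t + e * t"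
        using DERIV_pos_inc_left[of "\<lambda>x. k x + e * x" "D + e" t] k e by auto
      define h where "h = min (d/2) (t - a)"
      have h: "h > 0" "h < d" "a \<le> t - h" using d t by (auto simp: h_def)
      have "g (t - h) \<le> g t"
        using d(2)[OF h(1,2)] k(3)[of "t - h"] h mult_left_mono[OF mono[of "t - h" t] L0]
        unfolding g_def by (simp add: algebra_simps)
      then show ?thesis using h by (intro bexI[of _ "t - h"]) auto
    qed
    have "g a \<le> g b"
    proof (rule ccontr)
      assume *: "\<not> g a \<le> g b"
      \<comment> \<open>The closed set \<open>?K\<close> has a least element. Unless this is
        \<open>a\<close>, one more step to the left stays in \<open>?K\<close> and contradicts
        minimality.\<close>
      let ?K = "{t\<in>{a..b}. g t \<le> g b}"
      have "closed ?K"
        by (intro continuous_on_closed_Collect_le contg continuous_intros)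
      moreover have "b \<in> ?K" "bdd_below ?K" using ab by auto
      ultimately have c: "Inf ?K \<in> ?K" by (intro closed_contains_Inf) auto
      with * have "Inf ?K \<in> {a<..b}" by (auto simp: less_le)
      then obtain u where u: "u \<in> {a..<Inf ?K}" "g u \<le> g (Inf ?K)" using step by blast
      then have "u \<in> ?K" using c by auto
      then have "Inf ?K \<le> u" by (rule cInf_lower) (use \<open>bdd_below ?K\<close> in auto)
      then show False using u by simp
    qed
    moreover have "\<psi> b \<le> e"
      using measure_mono_fmeasurable[of "U \<inter> {a..b}" U lebesgue] Um Ue meas[of b]
      unfolding \<psi>_def by auto
    then have "L * \<psi> b \<le> L * e" using L0 by (intro mult_left_mono)
    moreover have "0 \<le> L * \<psi> a" unfolding \<psi>_def using L0 by simp
    ultimately show ?thesis unfolding g_def diff_self mult_zero_right by linarith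
  qed
  show ?thesis
  proof (rule field_le_epsilon)
    fix e :: real assume "0 < e"
    \<comment> \<open>With \<open>e / c\<close> in place of \<open>e\<close>, the total error of
      \<open>key\<close> is exactly \<open>e\<close>.\<close>
    define c where "c = L + (b - a)"
    have "c > 0" using L0 ab by (simp add: c_def)
    have "f a \<le> f b + L * (e / c) + (e / c) * (b - a)"
      using key[of "e / c"] \<open>0 < e\<close> \<open>c > 0\<close> by simp
    also have "\<dots> = f b + c * (e / c)" unfolding c_def by (simp only: ring_distribs mult.commute add.assoc)
    finally have "f a \<le> f b + c * (e / c)" .
    then show "f a \<le> f b + e" using \<open>c > 0\<close> by simp
  qed
qed simp

section \<open>Supergradients of half the squared distance\<close>

text \<open>A supergradient of half the squared distance, in global form: the squared distance minus
  the squared norm is concave, so an inequality near \<open>x\<close> extends to all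
  \<open>y\<close>, and later arguments can test it at distant points.\<close>

definition sqdist_supergradient :: "'a::real_inner set \<Rightarrow> 'a \<Rightarrow> 'a \<Rightarrow> bool" where
  "sqdist_supergradient C x w \<longleftrightarrow>
    (\<forall>y. (infdist y C)\<^sup>2 \<le> (infdist x C)\<^sup>2 + 2 * (w \<bullet> (y - x)) + (norm (y - x))\<^sup>2)"

lemma infdist_attained:
  fixes C :: "'a::heine_borel set"
  assumes "closed C" "C \<noteq> {}"
  obtains c where "c \<in> C" "infdist x C = dist x c"
proof -
  obtain c where "c \<in> C" "\<And>z. z \<in> C \<Longrightarrow> dist x c \<le> dist x z"
    using distance_attains_inf[OF assms, of x] by blast
  then have "infdist x C = dist x c"
    by (intro antisym infdist_le) (auto simp: infdist_notempty assms intro: cINF_greatest)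
  then show thesis using \<open>c \<in> C\<close> that by blast
qed

text \<open>For the squared distance to a single point this is an identity. Taking a nearest point
  of the intermediate point keeps equality there and can only overestimate the distances at
  \<open>x\<close> and \<open>y\<close>.\<close>

lemma sqdist_semiconcave:
  fixes C :: "'a::euclidean_space set"
  assumes "closed C" "C \<noteq> {}" "0 \<le> r" "r \<le> 1"
  shows "(1 - r) * (infdist x C)\<^sup>2 + r * (infdist y C)\<^sup>2 - r * (1 - r) * (norm (y - x))\<^sup>2
    \<le> (infdist (x + r *\<^sub>R (y - x)) C)\<^sup>2"
proof -
  obtain c where c: "c \<in> C" "infdist (x + r *\<^sub>R (y - x)) C = dist (x + r *\<^sub>R (y - x)) c"
    using infdist_attained assms by metis
  have "(infdist x C)\<^sup>2 \<le> (norm (x - c))\<^sup>2" "(infdist y C)\<^sup>2 \<le> (norm (y - c))\<^sup>2"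
    using infdist_le[OF c(1)] infdist_nonneg by (auto simp: dist_norm[symmetric] intro!: power_mono)
  then have "(1 - r) * (infdist x C)\<^sup>2 + r * (infdist y C)\<^sup>2
      \<le> (1 - r) * (norm (x - c))\<^sup>2 + r * (norm (y - c))\<^sup>2"
    using assms by (intro add_mono mult_left_mono) auto
  also have "\<dots> = (norm (x + r *\<^sub>R (y - x) - c))\<^sup>2 + r * (1 - r) * (norm (y - x))\<^sup>2"
    unfolding power2_norm_eq_inner by (simp add: inner_simps inner_commute algebra_simps)
  finally show ?thesis unfolding c(2) dist_norm by simp
qed

text \<open>By the chain rule, \<open>d v\<close> is the candidate supergradient of half the square
  of the distance \<open>d\<close>. The limsup controls \<open>d\<close> only near \<open>x\<close>;
  semiconcavity along the segment to \<open>y\<close> carries the bound to \<open>y\<close>.\<close>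

lemma superdifferential_sqdist:
  fixes \<Omega> :: "'a::euclidean_space set"
  assumes "open \<Omega>" "frontier \<Omega> \<noteq> {}" "x \<in> \<Omega>" and v: "v \<in> superdifferential \<Omega> (boundary_dist \<Omega>) x"
  shows "sqdist_supergradient (frontier \<Omega>) x (boundary_dist \<Omega> x *\<^sub>R v)"
  unfolding sqdist_supergradient_def
proof
  fix y
  define d where "d z = infdist z (frontier \<Omega>)" for z
  have d0: "0 \<le> d z" for z by (simp add: d_def infdist_nonneg)
  show "(infdist y (frontier \<Omega>))\<^sup>2 \<le> (infdist x (frontier \<Omega>))\<^sup>2
      + 2 * ((boundary_dist \<Omega> x *\<^sub>R v) \<bullet> (y - x)) + (norm (y - x))\<^sup>2"
  proof (cases "y = x")
    case False
    have *: "(d y)\<^sup>2 - (d x)\<^sup>2 - (norm (y - x))\<^sup>2 \<le> 2 * d x * (v \<bullet> (y - x) + e * norm (y - x))"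
      if "0 < e" for e
    proof -
      define q where "q = v \<bullet> (y - x) + e * norm (y - x)"
      have "Limsup (at x within \<Omega>) (\<lambda>z. ereal ((d z - d x - v \<bullet> (z - x)) / norm (z - x))) < ereal e"
        using v that unfolding superdifferential_def boundary_dist_def d_def
        by (auto intro: le_less_trans)
      then have "\<forall>\<^sub>F z in at x within \<Omega>. (d z - d x - v \<bullet> (z - x)) / norm (z - x) < e"
        using Limsup_lessD by fastforce
      then have "\<forall>\<^sub>F z in at x. (d z - d x - v \<bullet> (z - x)) / norm (z - x) < e"
        by (simp add: at_within_open[OF assms(3,1)])
      \<comment> \<open>The superdifferential is tested on the segment from \<open>x\<close> to the
        fixed point \<open>y\<close>.\<close>
      moreover have "filterlim (\<lambda>r. x + r *\<^sub>R (y - x)) (at x) (at_right (0::real))"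
        using False by (intro filterlim_atI) (auto intro!: tendsto_eq_intros simp: eventually_at_filter)
      ultimately have ev: "\<forall>\<^sub>F r in at_right (0::real).
          (d (x + r *\<^sub>R (y - x)) - d x - v \<bullet> (r *\<^sub>R (y - x))) / norm (r *\<^sub>R (y - x)) < e"
        by (auto simp: filterlim_iff)
      have ev1: "\<forall>\<^sub>F r in at_right (0::real). r \<in> {0<..<1}"
        by (rule eventually_at_right_real) simp
      have lim: "\<forall>\<^sub>F r in at_right (0::real).
          (d y)\<^sup>2 - (d x)\<^sup>2 - (1 - r) * (norm (y - x))\<^sup>2 \<le> 2 * d x * q + r * q\<^sup>2"
        using ev ev1
      proof eventually_elim
        case (elim r)
        then have r: "0 < r" "r < 1" by auto
        have "d (x + r *\<^sub>R (y - x)) \<le> d x + r * q"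
        proof -
          have "d (x + r *\<^sub>R (y - x)) - d x - r * (v \<bullet> (y - x)) < e * (r * norm (y - x))"
            using elim r False by (simp add: pos_divide_less_eq)
          then show ?thesis by (simp add: q_def algebra_simps)
        qed
        then have "(d (x + r *\<^sub>R (y - x)))\<^sup>2 \<le> (d x + r * q)\<^sup>2"
          using d0 by (intro power_mono)
        moreover have "(1 - r) * (d x)\<^sup>2 + r * (d y)\<^sup>2 - r * (1 - r) * (norm (y - x))\<^sup>2
            \<le> (d (x + r *\<^sub>R (y - x)))\<^sup>2"
          unfolding d_def using r assms by (intro sqdist_semiconcave) auto
        \<comment> \<open>The term \<open>(d x)\<^sup>2\<close> cancels between the upper and the
          lower bound, and what remains carries a factor \<open>r\<close>.\<close>
        ultimately have "r * ((d y)\<^sup>2 - (d x)\<^sup>2 - (1 - r) * (norm (y - x))\<^sup>2) \<le> r * (2 * d x * q + r * q\<^sup>2)"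
          by (simp add: algebra_simps power2_eq_square)
        then show ?case using r by simp
      qed
      have "(d y)\<^sup>2 - (d x)\<^sup>2 - (1 - 0) * (norm (y - x))\<^sup>2 \<le> 2 * d x * q + 0 * q\<^sup>2"
        by (rule tendsto_le[OF _ _ _ lim]) (auto intro!: tendsto_eq_intros)
      then show ?thesis by (simp add: q_def)
    qed
    have "(d y)\<^sup>2 - (d x)\<^sup>2 - (norm (y - x))\<^sup>2 \<le> 2 * d x * (v \<bullet> (y - x) + 0 * norm (y - x))"
    proof (rule tendsto_le[OF trivial_limit_at_right_real])
      show "((\<lambda>e. 2 * d x * (v \<bullet> (y - x) + e * norm (y - x))) \<longlongrightarrow>
          2 * d x * (v \<bullet> (y - x) + 0 * norm (y - x))) (at_right 0)"
        by (intro tendsto_intros)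
      show "\<forall>\<^sub>F e in at_right 0. (d y)\<^sup>2 - (d x)\<^sup>2 - (norm (y - x))\<^sup>2
          \<le> 2 * d x * (v \<bullet> (y - x) + e * norm (y - x))"
        by (rule eventually_mono[OF eventually_at_right_less *])
    qed (rule tendsto_const)
    then show ?thesis by (simp add: d_def boundary_dist_def algebra_simps)
  qed simp
qed

text \<open>The distance is 1-Lipschitz, so it drops by at most \<open>r * norm w\<close> on moving
  to \<open>x - r *\<^sub>R w\<close>; comparing with the drop that the supergradient inequality
  predicts bounds \<open>norm w\<close>.\<close>

lemma sqdist_supergradient_norm_le:
  fixes C :: "'a::euclidean_space set"
  assumes "sqdist_supergradient C x w" "0 < infdist x C"
  shows "norm w \<le> infdist x C"
proof (cases "w = 0")
  case False
  let ?d = "infdist x C"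
  \<comment> \<open>This is the largest step for which \<open>?d - r * norm w\<close> is still
    nonnegative, as squaring requires; any smaller positive step would do.\<close>
  define r where "r = ?d / norm w"
  have r: "r > 0" "r * norm w = ?d" using assms False by (auto simp: r_def)
  have bound: "norm w \<le> ?d" if "0 < r" "r * norm w \<le> ?d" for r
  proof -
    have "?d - r * norm w \<le> infdist (x - r *\<^sub>R w) C"
      using infdist_triangle[of x C "x - r *\<^sub>R w"] that by (simp add: dist_norm)
    then have "(?d - r * norm w)\<^sup>2 \<le> (infdist (x - r *\<^sub>R w) C)\<^sup>2"
      using that by (intro power_mono) auto
    also have "\<dots> \<le> ?d\<^sup>2 + 2 * (w \<bullet> (x - r *\<^sub>R w - x)) + (norm (x - r *\<^sub>R w - x))\<^sup>2"
      using assms unfolding sqdist_supergradient_def by blast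
    finally have "2 * r * (norm w * norm w) \<le> 2 * r * (?d * norm w)"
      by (simp add: power2_eq_square algebra_simps power2_norm_eq_inner[symmetric] dot_square_norm)
    then show ?thesis using that False by simp
  qed
  show ?thesis using bound[of r] r by simp
qed (simp add: infdist_nonneg)

text \<open>The sum of the two supergradient inequalities. This one-sided Lipschitz bound with
  constant 1 is what makes orbits diverge at most like the exponential.\<close>

lemma sqdist_supergradient_monotone:
  assumes "sqdist_supergradient C x w" "sqdist_supergradient C x' w'"
  shows "(w' - w) \<bullet> (x' - x) \<le> (norm (x' - x))\<^sup>2"
proof -
  have "(infdist x' C)\<^sup>2 \<le> (infdist x C)\<^sup>2 + 2 * (w \<bullet> (x' - x)) + (norm (x' - x))\<^sup>2"
    "(infdist x C)\<^sup>2 \<le> (infdist x' C)\<^sup>2 + 2 * (w' \<bullet> (x - x')) + (norm (x - x'))\<^sup>2"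
    using assms unfolding sqdist_supergradient_def by blast+
  then show ?thesis by (simp add: inner_simps norm_minus_commute algebra_simps)
qed

section \<open>Differentiability inside a segment to a nearest point\<close>

lemma has_derivative_norm_diff:
  fixes x c :: "'a::real_inner"
  assumes "x \<noteq> c"
  shows "((\<lambda>y. norm (y - c)) has_derivative (\<lambda>h. (x - c) \<bullet> h / norm (x - c))) (at x)"
proof -
  have "((\<lambda>y. norm (y - c)) has_derivative (\<lambda>h. h \<bullet> sgn (x - c))) (at x)"
    by (rule has_derivative_compose[where f="\<lambda>y. y - c" and g=norm])
       (use assms in \<open>auto intro!: derivative_eq_intros has_derivative_norm\<close>)
  then show ?thesis by (simp add: sgn_div_norm inner_commute divide_inverse mult.commute)
qed

text \<open>The assumption on \<open>z\<close> forces equality in the triangle inequality, so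
  \<open>x\<close> lies between \<open>z\<close> and \<open>c\<close>. The distance to
  \<open>c\<close> from above and a downward cone with apex \<open>z\<close> from below both touch
  the distance function at \<open>x\<close>, with a common gradient.\<close>

lemma differentiable_infdist_interior_segment:
  fixes C :: "'a::euclidean_space set"
  assumes c: "c \<in> C" "infdist x C = norm (x - c)" and pos: "0 < infdist x C" and "z \<noteq> x"
    and z: "norm (z - x) + infdist x C \<le> infdist z C"
  shows "(\<lambda>y. infdist y C) differentiable (at x)"
proof -
  have "infdist z C \<le> norm (z - c)" using infdist_le[OF c(1)] by (simp add: dist_norm)
  then have "norm ((z - x) + (x - c)) = norm (z - x) + norm (x - c)"
    using z c norm_triangle_ineq[of "z - x" "x - c"] by simp
  then have par: "norm (z - x) *\<^sub>R (x - c) = norm (x - c) *\<^sub>R (z - x)"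
    by (rule norm_triangle_eq[THEN iffD1])
  define u where "u y = norm (y - c)" for y
  define l where "l y = infdist z C - norm (y - z)" for y
  define D where "D h = (x - c) \<bullet> h / norm (x - c)" for h
  have xc: "x \<noteq> c" using pos c by auto
  have du: "(u has_derivative D) (at x)"
    unfolding u_def D_def by (rule has_derivative_norm_diff[OF xc])
  have dl: "(l has_derivative D) (at x)"
  proof -
    have "(l has_derivative (\<lambda>h. (z - x) \<bullet> h / norm (z - x))) (at x)"
      unfolding l_def using \<open>z \<noteq> x\<close>
      by (auto intro!: derivative_eq_intros has_derivative_norm_diff
            simp: norm_minus_commute inner_diff_left diff_divide_distrib)
    moreover have "(z - x) \<bullet> h / norm (z - x) = D h" for h
    proof -
      have "norm (z - x) * ((x - c) \<bullet> h) = norm (x - c) * ((z - x) \<bullet> h)"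
        using arg_cong[OF par, of "\<lambda>a. a \<bullet> h"] by simp
      then show ?thesis using xc \<open>z \<noteq> x\<close> unfolding D_def by (simp add: field_simps)
    qed
    ultimately show ?thesis by simp
  qed
  have le: "l y \<le> infdist y C" "infdist y C \<le> u y" for y
    using infdist_triangle[of z C y] infdist_le[OF c(1), of y]
    by (auto simp: l_def u_def dist_norm norm_minus_commute)
  have eq: "l x = infdist x C" "u x = infdist x C"
    using z c le[of x] by (auto simp: l_def u_def norm_minus_commute)
  have "((\<lambda>y. infdist y C) has_derivative D) (at x)"
    unfolding has_derivative_at_within
  proof (intro conjI)
    show "bounded_linear D" using du has_derivative_bounded_linear by blast
    \<comment> \<open>The three functions agree at \<open>x\<close> and are compared with the same
      \<open>D\<close>, so their remainders are ordered as they are.\<close>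
    show "((\<lambda>y. (infdist y C - infdist x C - D (y - x)) /\<^sub>R norm (y - x)) \<longlongrightarrow> 0) (at x)"
    proof (rule tendsto_sandwich)
      show "((\<lambda>y. (l y - l x - D (y - x)) /\<^sub>R norm (y - x)) \<longlongrightarrow> 0) (at x)"
        using dl unfolding has_derivative_at_within by blast
      show "((\<lambda>y. (u y - u x - D (y - x)) /\<^sub>R norm (y - x)) \<longlongrightarrow> 0) (at x)"
        using du unfolding has_derivative_at_within by blast
    qed (auto intro!: always_eventually mult_left_mono simp: eq le)
  qed
  then show ?thesis unfolding differentiable_def by blast
qed

section \<open>Lipschitz bounds for products and exponentials\<close>

text \<open>Both factors are bounded on a compact set. Together with the bound for exponentials this
  supplies the Lipschitz hypothesis of \<open>lipschitz_nondecreasing_ae\<close>; products of reals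
  are covered too, being inner products.\<close>

lemma lipschitz_on_inner_compact:
  fixes f g :: "'b::metric_space \<Rightarrow> 'a::real_inner"
  assumes "compact S" and f: "L-lipschitz_on S f" and g: "M-lipschitz_on S g"
  shows "\<exists>K. K-lipschitz_on S (\<lambda>t. f t \<bullet> g t)"
proof -
  have "bounded (f ` S)" "bounded (g ` S)"
    using assms by (auto intro!: compact_imp_bounded compact_continuous_image lipschitz_on_continuous_on)
  then obtain A B where A: "A > 0" "\<And>x. x \<in> S \<Longrightarrow> norm (f x) \<le> A"
      and B: "B > 0" "\<And>x. x \<in> S \<Longrightarrow> norm (g x) \<le> B"
    unfolding bounded_pos by (metis imageI)
  have LM: "L \<ge> 0" "M \<ge> 0" using f g lipschitz_on_nonneg by auto
  have "(A * M + L * B)-lipschitz_on S (\<lambda>t. f t \<bullet> g t)"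
  proof (rule lipschitz_onI)
    fix x y assume xy: "x \<in> S" "y \<in> S"
    have "\<bar>f x \<bullet> g x - f y \<bullet> g y\<bar> = \<bar>f x \<bullet> (g x - g y) + (f x - f y) \<bullet> g y\<bar>"
      by (simp add: inner_diff_left inner_diff_right)
    also have "\<dots> \<le> norm (f x) * norm (g x - g y) + norm (f x - f y) * norm (g y)"
      by (intro order_trans[OF abs_triangle_ineq] add_mono Cauchy_Schwarz_ineq2)
    also have "\<dots> \<le> A * (M * dist x y) + (L * dist x y) * B"
      using A B xy lipschitz_onD[OF f xy] lipschitz_onD[OF g xy] LM
      by (intro add_mono mult_mono) (auto simp: dist_norm)
    finally show "dist (f x \<bullet> g x) (f y \<bullet> g y) \<le> (A * M + L * B) * dist x y"
      by (simp add: dist_real_def algebra_simps)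
  qed (use A B LM in simp)
  then show ?thesis by blast
qed

lemma lipschitz_on_exp_affine:
  fixes a b c d :: real
  shows "\<exists>K. K-lipschitz_on {a..b} (\<lambda>t. exp (c * t + d))"
proof -
  have "bounded ((\<lambda>t. c * exp (c * t + d)) ` {a..b})"
    by (intro compact_imp_bounded compact_continuous_image continuous_intros) auto
  then obtain K where K: "K > 0" "\<And>t. t \<in> {a..b} \<Longrightarrow> \<bar>c * exp (c * t + d)\<bar> \<le> K"
    unfolding bounded_pos by (metis imageI real_norm_def)
  have "K-lipschitz_on {a..b} (\<lambda>t. exp (c * t + d))"
  proof (rule bounded_derivative_imp_lipschitz)
    fix t assume t: "t \<in> {a..b}"
    show "((\<lambda>t. exp (c * t + d)) has_derivative (\<lambda>h. (c * exp (c * t + d)) * h)) (at t within {a..b})"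
      by (auto intro!: derivative_eq_intros)
    show "onorm (\<lambda>h. (c * exp (c * t + d)) * h) \<le> K"
    proof (rule onorm_bound)
      show "norm (c * exp (c * t + d) * h) \<le> K * norm h" for h
        using mult_right_mono[OF K(2)[OF t] abs_ge_zero[of h]] by (simp add: abs_mult)
    qed (use K in simp)
  qed (use K in auto)
  then show ?thesis by blast
qed

section \<open>Supergradients near a point of differentiability\<close>

text \<open>The upper bound uses \<open>c\<close> as competitor; the lower one is the triangle
  inequality from \<open>z\<close>.\<close>

lemma infdist_along_projection_segment:
  fixes z c :: "'a::real_normed_vector"
  assumes "c \<in> C" "infdist z C = norm (z - c)" "0 \<le> t" "t \<le> 1"
  shows "infdist (z + t *\<^sub>R (c - z)) C = (1 - t) * infdist z C"
proof (rule antisym)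
  have "(z + t *\<^sub>R (c - z)) - c = (1 - t) *\<^sub>R (z - c)" by (simp add: algebra_simps)
  then have "norm ((z + t *\<^sub>R (c - z)) - c) = (1 - t) * norm (z - c)"
    using assms by (metis abs_of_nonneg diff_ge_0_iff_ge norm_scaleR)
  then show "infdist (z + t *\<^sub>R (c - z)) C \<le> (1 - t) * infdist z C"
    using infdist_le[OF assms(1)] assms(2) by (metis dist_norm)
  have "infdist z C \<le> infdist (z + t *\<^sub>R (c - z)) C + t * norm (z - c)"
    using infdist_triangle[of z C "z + t *\<^sub>R (c - z)"] assms by (simp add: dist_norm norm_minus_commute)
  then show "(1 - t) * infdist z C \<le> infdist (z + t *\<^sub>R (c - z)) C"
    using assms(2) by (simp add: algebra_simps)
qed

text \<open>The direction \<open>e\<close> points away from a nearest point, and the distance has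
  slope 1 along it: from the left always, hence on both sides by differentiability. Testing a
  supergradient at a short displacement along \<open>e\<close> then bounds its component from below,
  and the test is stable under moving the base point.\<close>

lemma sqdist_supergradients_near_differentiable:
  fixes C :: "'a::euclidean_space set"
  assumes "closed C" "C \<noteq> {}" and pos: "0 < infdist z C"
    and diff: "(\<lambda>y. infdist y C) differentiable (at z)"
  obtains e where "norm e = 1" "\<And>\<epsilon>. 0 < \<epsilon> \<Longrightarrow>
    \<forall>\<^sub>F x in nhds z. \<forall>w. sqdist_supergradient C x w \<longrightarrow> infdist z C - \<epsilon> < w \<bullet> e"
proof -
  let ?d = "infdist z C"
  obtain c where c: "c \<in> C" "?d = norm (z - c)" using infdist_attained assms by (metis dist_norm)
  define e where "e = (z - c) /\<^sub>R ?d"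
  have e: "norm e = 1" using pos c by (simp add: e_def)
  define k where "k \<rho> = infdist (z + \<rho> *\<^sub>R e) C" for \<rho>
  have k0: "k 0 = ?d" by (simp add: k_def)
  \<comment> \<open>The slope of \<open>k\<close> at 0 can be read off from the left, along the segment to the nearest point.\<close>
  have left: "k \<rho> = ?d + \<rho>" if "\<rho> \<in> {-?d..0}" for \<rho>
  proof -
    have "z + \<rho> *\<^sub>R e = z + (- \<rho> / ?d) *\<^sub>R (c - z)"
      using pos by (simp add: e_def algebra_simps divide_inverse)
    then have "k \<rho> = (1 - (- \<rho> / ?d)) * ?d"
      unfolding k_def using pos that
      by (simp only:) (intro infdist_along_projection_segment c, auto simp: field_simps)
    then show ?thesis using pos by (simp add: ring_distribs)
  qed
  obtain D where "((\<lambda>y. infdist y C) has_derivative D) (at (z + 0 *\<^sub>R e))"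
    using diff unfolding differentiable_def by auto
  then have "((\<lambda>\<rho>. infdist (z + \<rho> *\<^sub>R e) C) has_derivative (\<lambda>\<rho>. D (\<rho> *\<^sub>R e))) (at 0)"
    by (rule has_derivative_compose[rotated]) (auto intro!: derivative_eq_intros)
  then have "k differentiable (at 0)" unfolding k_def differentiable_def by blast
  then obtain m where m: "(k has_real_derivative m) (at 0)"
    using real_differentiableE by blast
  have "m = 1"
  proof (rule vector_derivative_unique_within)
    show "at 0 within {-?d..0} \<noteq> bot"
      using pos by (simp add: trivial_limit_within islimpt_Icc)
    show "(k has_vector_derivative m) (at 0 within {-?d..0})"
      using m by (metis has_field_derivative_at_within has_real_derivative_iff_has_vector_derivative)
    have "((\<lambda>\<rho>. ?d + \<rho>) has_vector_derivative 1) (at 0 within {-?d..0})"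
      by (auto intro!: derivative_eq_intros)
    then show "(k has_vector_derivative 1) (at 0 within {-?d..0})"
      by (rule has_vector_derivative_transform[rotated 2]) (use left pos in auto)
  qed
  have "\<forall>\<^sub>F x in nhds z. \<forall>w. sqdist_supergradient C x w \<longrightarrow> ?d - \<epsilon> < w \<bullet> e" if "0 < \<epsilon>" for \<epsilon>
  proof -
    \<comment> \<open>As \<open>k\<close> has slope 1 at 0 and \<open>k 0 = ?d\<close>, the
      derivative of \<open>g\<close> at 0 is \<open>2 * \<epsilon>\<close>, so some small positive
      \<open>\<rho>\<close> gives a strict inequality.\<close>
    define g where "g \<rho> = (k \<rho>)\<^sup>2 - \<rho>\<^sup>2 - 2 * (?d - \<epsilon>) * \<rho>" for \<rho>
    have "(g has_real_derivative 2 * \<epsilon>) (at 0)"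
      unfolding g_def by (auto intro!: derivative_eq_intros m simp: k0 \<open>m = 1\<close>)
    then obtain r where r: "r > 0" "\<And>h. h > 0 \<Longrightarrow> h < r \<Longrightarrow> g 0 < g (0 + h)"
      using DERIV_pos_inc_right[of g "2 * \<epsilon>" 0] \<open>0 < \<epsilon>\<close> by auto
    define \<rho> where "\<rho> = r / 2"
    have \<rho>: "\<rho> > 0" "?d\<^sup>2 < (infdist (z + \<rho> *\<^sub>R e) C)\<^sup>2 - \<rho>\<^sup>2 - 2 * (?d - \<epsilon>) * \<rho>"
      using r(1) r(2)[of \<rho>] by (auto simp: \<rho>_def g_def k_def)
    \<comment> \<open>With \<open>\<rho>\<close> now fixed, continuity in the base point preserves
      the strict inequality near \<open>z\<close>.\<close>
    have "((\<lambda>x. (infdist (x + \<rho> *\<^sub>R e) C)\<^sup>2 - \<rho>\<^sup>2 - 2 * (?d - \<epsilon>) * \<rho> - (infdist x C)\<^sup>2) \<longlongrightarrow>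
        (infdist (z + \<rho> *\<^sub>R e) C)\<^sup>2 - \<rho>\<^sup>2 - 2 * (?d - \<epsilon>) * \<rho> - ?d\<^sup>2) (nhds z)"
      by (intro tendsto_intros filterlim_ident)
    then have "\<forall>\<^sub>F x in nhds z. 0 < (infdist (x + \<rho> *\<^sub>R e) C)\<^sup>2 - \<rho>\<^sup>2 - 2 * (?d - \<epsilon>) * \<rho> - (infdist x C)\<^sup>2"
      by (rule order_tendstoD) (use \<rho> in simp)
    then show ?thesis
    proof (rule eventually_mono, intro allI impI)
      fix x w
      assume x: "0 < (infdist (x + \<rho> *\<^sub>R e) C)\<^sup>2 - \<rho>\<^sup>2 - 2 * (?d - \<epsilon>) * \<rho> - (infdist x C)\<^sup>2"
        and "sqdist_supergradient C x w"
      then have "(infdist (x + \<rho> *\<^sub>R e) C)\<^sup>2 \<le> (infdist x C)\<^sup>2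
          + 2 * (w \<bullet> (x + \<rho> *\<^sub>R e - x)) + (norm (x + \<rho> *\<^sub>R e - x))\<^sup>2"
        unfolding sqdist_supergradient_def by blast
      then have "(2 * \<rho>) * (?d - \<epsilon>) < (2 * \<rho>) * (w \<bullet> e)"
        using x e \<rho>(1) by (simp add: algebra_simps)
      then show "?d - \<epsilon> < w \<bullet> e" using \<rho>(1) by simp
    qed
  qed
  with e show thesis using that by blast
qed

section \<open>The rescaled flow and the contraction of its increments\<close>

text \<open>The arc in the time \<open>s\<close> with \<open>dt = d ds\<close>; in this time the comparison of two orbits is linear.\<close>

locale sqdist_flow =
  fixes C :: "'a::euclidean_space set" and \<beta> :: "real \<Rightarrow> 'a" and B L :: real and N :: "real set"
  assumes closed: "closed C" and nonempty: "C \<noteq> {}"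
    and pos: "s \<in> {0..B} \<Longrightarrow> 0 < infdist (\<beta> s) C"
    and lip: "L-lipschitz_on {0..B} \<beta>"
    and negl: "negligible N"
    and flow: "s \<in> {0<..<B} - N \<Longrightarrow>
      \<exists>w. (\<beta> has_vector_derivative w) (at s) \<and> sqdist_supergradient C (\<beta> s) w"
begin

text \<open>An orbit and its shift by \<open>h\<close> satisfy the one-sided Lipschitz bound, so
  their squared distance grows at most at rate 2 relative to itself. Finite increments stand in for
  velocities, which exist only almost everywhere.\<close>

lemma increment_contraction:
  assumes "0 \<le> s" "s \<le> s'" "0 \<le> h" "s' + h \<le> B"
  shows "exp (- s') * norm (\<beta> (s' + h) - \<beta> s') \<le> exp (- s) * norm (\<beta> (s + h) - \<beta> s)"
proof -
  define e where "e t = \<beta> (t + h) - \<beta> t" for t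
  \<comment> \<open>The sign turns the decrease into an increase. The inner product of reals and the
    summand 0 fit the shapes of the two Lipschitz lemmas.\<close>
  define f where "f t = - (exp (- 2 * t + 0) \<bullet> (e t \<bullet> e t))" for t
  have "f s \<le> f s'"
  proof -
    have lipe: "(L + L)-lipschitz_on {s..s'} e"
    proof -
      have "(L * 1)-lipschitz_on {s..s'} (\<lambda>t. \<beta> (t + h))"
      proof (rule lipschitz_on_compose2[where f="\<lambda>t. t + h" and g=\<beta>])
        show "1-lipschitz_on {s..s'} (\<lambda>t. t + h)" by (rule lipschitz_onI) (auto simp: dist_real_def)
        show "L-lipschitz_on ((\<lambda>t. t + h) ` {s..s'}) \<beta>"
          by (rule lipschitz_on_subset[OF lip]) (use assms in auto)
      qed
      then show ?thesis unfolding e_def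
        by (intro lipschitz_on_diff) (use assms in \<open>auto intro!: lipschitz_on_subset[OF lip]\<close>)
    qed
    obtain K where "K-lipschitz_on {s..s'} f"
    proof -
      obtain K1 where "K1-lipschitz_on {s..s'} (\<lambda>t. e t \<bullet> e t)"
        using lipschitz_on_inner_compact[OF _ lipe lipe] by auto
      then obtain K2 where "K2-lipschitz_on {s..s'} (\<lambda>t. exp (- 2 * t + 0) \<bullet> (e t \<bullet> e t))"
        using lipschitz_on_inner_compact[OF compact_Icc] lipschitz_on_exp_affine by metis
      then show thesis using that unfolding f_def by (metis lipschitz_on_minus)
    qed
    then show ?thesis
    proof (rule lipschitz_nondecreasing_ae[OF \<open>s \<le> s'\<close>])
      \<comment> \<open>Both \<open>t\<close> and \<open>t + h\<close> must avoid
        \<open>N\<close>.\<close>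
      show "negligible (N \<union> (+) (- h) ` N)"
        by (intro negligible_Un negl negligible_translation)
      fix t assume t: "t \<in> {s<..<s'} - (N \<union> (+) (- h) ` N)"
      have "t + h \<notin> N"
      proof
        assume "t + h \<in> N"
        then have "(-h) + (t + h) \<in> (+) (- h) ` N" by blast
        then show False using t by simp
      qed
      then obtain w w' where w: "(\<beta> has_vector_derivative w) (at t)" "sqdist_supergradient C (\<beta> t) w"
          and w': "(\<beta> has_vector_derivative w') (at (t + h))" "sqdist_supergradient C (\<beta> (t + h)) w'"
        using flow[of t] flow[of "t + h"] t assms by auto
      have "((\<beta> \<circ> (\<lambda>t. t + h)) has_vector_derivative 1 *\<^sub>R w') (at t)"
        by (rule vector_diff_chain_at) (auto intro!: derivative_eq_intros w')
      then have e': "(e has_vector_derivative w' - w) (at t)"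
        unfolding e_def using w(1) by (auto intro!: derivative_eq_intros simp: o_def)
      have "((\<lambda>t. e t \<bullet> e t) has_real_derivative e t \<bullet> (w' - w) + (w' - w) \<bullet> e t) (at t)"
        unfolding has_real_derivative_iff_has_vector_derivative
        by (rule bounded_bilinear.has_vector_derivative[OF bounded_bilinear_inner e' e'])
      then have "(f has_real_derivative 2 * exp (- 2 * t) * (e t \<bullet> e t - (w' - w) \<bullet> e t)) (at t)"
        unfolding f_def inner_real_def
        by (auto intro!: derivative_eq_intros simp: inner_commute algebra_simps)
      moreover have "(w' - w) \<bullet> e t \<le> e t \<bullet> e t"
        using sqdist_supergradient_monotone[OF w(2) w'(2)] unfolding e_def by (simp add: dot_square_norm)
      ultimately show "\<exists>k D. (k has_real_derivative D) (at t) \<and> 0 \<le> D \<and> (\<forall>u\<in>{s..<t}. k t - k u \<le> f t - f u)"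
        by (intro exI[of _ f] exI) auto
    qed
  qed
  then have "(exp (- s') * norm (e s'))\<^sup>2 \<le> (exp (- s) * norm (e s))\<^sup>2"
    unfolding f_def by (simp add: dot_square_norm power_mult_distrib exp_double[symmetric])
  then show ?thesis unfolding e_def by (rule power2_le_imp_le) simp
qed

text \<open>A velocity at \<open>s\<close> itself may not exist. Shortly afterwards almost all
  velocities are supergradients at nearby points, hence have component above
  \<open>infdist (\<beta> s) C - \<epsilon>\<close> in one common direction; this accumulates over
  the time \<open>h\<close>.\<close>

lemma increment_lower_bound_at_differentiable:
  assumes s: "0 \<le> s" "s < B" and diff: "(\<lambda>y. infdist y C) differentiable (at (\<beta> s))" and "0 < \<epsilon>"
  shows "\<forall>\<^sub>F h in at_right 0. (infdist (\<beta> s) C - \<epsilon>) * h \<le> norm (\<beta> (s + h) - \<beta> s)"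
proof -
  let ?d = "infdist (\<beta> s) C"
  have "0 < ?d" using pos s by simp
  then obtain e where e: "norm e = 1"
    "\<forall>\<^sub>F x in nhds (\<beta> s). \<forall>w. sqdist_supergradient C x w \<longrightarrow> ?d - \<epsilon> < w \<bullet> e"
    using sqdist_supergradients_near_differentiable[OF closed nonempty _ diff] \<open>0 < \<epsilon>\<close> by blast
  have "(\<beta> \<longlongrightarrow> \<beta> s) (at s within {0..B})"
    using lipschitz_on_continuous_on[OF lip] s by (simp add: continuous_on)
  then have "\<forall>\<^sub>F t in at s within {0..B}. \<forall>w. sqdist_supergradient C (\<beta> t) w \<longrightarrow> ?d - \<epsilon> < w \<bullet> e"
    using e(2) by (auto simp: filterlim_iff)
  then obtain r where r: "r > 0"
    "\<And>t w. t \<in> {0..B} \<Longrightarrow> t \<noteq> s \<Longrightarrow> dist t s < r \<Longrightarrow> sqdist_supergradient C (\<beta> t) w \<Longrightarrow> ?d - \<epsilon> < w \<bullet> e"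
    unfolding eventually_at by metis
  have "(?d - \<epsilon>) * h \<le> norm (\<beta> (s + h) - \<beta> s)" if h: "0 < h" "h < min r (B - s)" for h
  proof -
    define f where "f t = e \<bullet> \<beta> t - (?d - \<epsilon>) * t" for t
    have sub: "{s..s + h} \<subseteq> {0..B}" using s h by auto
    obtain K where "K-lipschitz_on {s..s+h} f"
    proof -
      obtain K where "K-lipschitz_on {s..s+h} (\<lambda>t. e \<bullet> \<beta> t)"
        using lipschitz_on_inner_compact[OF compact_Icc lipschitz_on_constant lipschitz_on_subset[OF lip sub]] by metis
      moreover have "(\<bar>?d - \<epsilon>\<bar> * 1)-lipschitz_on {s..s+h} (\<lambda>t. (?d - \<epsilon>) * t)"
        by (rule lipschitz_on_cmult_real[OF lipschitz_on_id])
      ultimately show thesis using that lipschitz_on_diff unfolding f_def by blast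
    qed
    then have "f s \<le> f (s + h)"
    proof (rule lipschitz_nondecreasing_ae[OF _ _ negl, rotated])
      fix t assume t: "t \<in> {s<..<s+h} - N"
      then obtain w where w: "(\<beta> has_vector_derivative w) (at t)" "sqdist_supergradient C (\<beta> t) w"
        using flow[of t] s h by auto
      have "((\<lambda>t. e \<bullet> \<beta> t) has_real_derivative e \<bullet> w) (at t)"
        using bounded_linear.has_vector_derivative[OF bounded_linear_inner_right w(1)]
        by (simp add: has_real_derivative_iff_has_vector_derivative)
      then have "(f has_real_derivative e \<bullet> w - (?d - \<epsilon>)) (at t)"
        unfolding f_def by (auto intro!: derivative_eq_intros)
      moreover have "?d - \<epsilon> < w \<bullet> e" using r(2)[OF _ _ _ w(2)] t h s by (auto simp: dist_real_def)
      ultimately show "\<exists>k D. (k has_real_derivative D) (at t) \<and> 0 \<le> D \<and> (\<forall>u\<in>{s..<t}. k t - k u \<le> f t - f u)"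
        by (intro exI[of _ f] exI) (auto simp: inner_commute)
    qed (use h in simp)
    then have "(?d - \<epsilon>) * h \<le> e \<bullet> (\<beta> (s + h) - \<beta> s)"
      unfolding f_def by (simp add: algebra_simps)
    also have "\<dots> \<le> norm (\<beta> (s + h) - \<beta> s)"
      using norm_cauchy_schwarz[of e] e(1) by (metis mult_1)
    finally show ?thesis .
  qed
  then show ?thesis
    unfolding eventually_at_right_field using r(1) s by (intro exI[of _ "min r (B - s)"]) auto
qed

section \<open>Consequences of differentiability at a later point of the orbit\<close>

context
  fixes s1 :: real
  assumes s1: "0 < s1" "s1 < B" and diff: "(\<lambda>y. infdist y C) differentiable (at (\<beta> s1))"
begin

text \<open>The contraction compares increments of equal length \<open>h\<close> at \<open>s\<close>
  and at \<open>s1\<close>. Near \<open>s\<close> the increment is \<open>h\<close> times the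
  velocity up to a small error, and at \<open>s1\<close> it is bounded below by differentiability of
  the distance.\<close>

lemma speed_lower_bound:
  assumes s: "0 \<le> s" "s < s1" and w: "(\<beta> has_vector_derivative w) (at s)"
  shows "infdist (\<beta> s1) C * exp (s - s1) \<le> norm w"
proof (rule field_le_epsilon)
  fix \<epsilon> :: real assume \<epsilon>: "0 < \<epsilon>"
  let ?d = "infdist (\<beta> s1) C"
  have "\<forall>\<epsilon>>0. \<forall>\<^sub>F y in at s. norm (\<beta> y - \<beta> s - (y - s) *\<^sub>R w) \<le> \<epsilon> * norm (y - s)"
    using w unfolding has_vector_derivative_def has_derivative_within_alt2 by blast
  then have "\<forall>\<^sub>F y in at s. norm (\<beta> y - \<beta> s - (y - s) *\<^sub>R w) \<le> \<epsilon>/2 * norm (y - s)"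
    using half_gt_zero[OF \<epsilon>] by blast
  then have ev1: "\<forall>\<^sub>F h in at_right 0. norm (\<beta> (s + h) - \<beta> s - h *\<^sub>R w) \<le> \<epsilon>/2 * h"
    unfolding eventually_at_to_0[of _ s] eventually_at_filter[of _ 0]
    by (auto elim!: eventually_mono simp: add.commute)
  have ev2: "\<forall>\<^sub>F h in at_right 0. (?d - \<epsilon>/2) * h \<le> norm (\<beta> (s1 + h) - \<beta> s1)"
    by (rule increment_lower_bound_at_differentiable) (use s1 diff \<epsilon> in auto)
  have ev3: "\<forall>\<^sub>F h in at_right 0. h \<in> {0<..<B - s1}"
    by (rule eventually_at_right_real) (use s1 in simp)
  obtain h where h: "0 < h" "h < B - s1" "norm (\<beta> (s + h) - \<beta> s - h *\<^sub>R w) \<le> \<epsilon>/2 * h"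
    "(?d - \<epsilon>/2) * h \<le> norm (\<beta> (s1 + h) - \<beta> s1)"
    using eventually_happens[OF eventually_conj[OF ev1 eventually_conj[OF ev2 ev3]]] by auto
  have "exp (- s1) * norm (\<beta> (s1 + h) - \<beta> s1) \<le> exp (- s) * norm (\<beta> (s + h) - \<beta> s)"
    by (rule increment_contraction) (use s h in auto)
  then have "exp s * (exp (- s1) * norm (\<beta> (s1 + h) - \<beta> s1)) \<le> exp s * (exp (- s) * norm (\<beta> (s + h) - \<beta> s))"
    by (intro mult_left_mono) auto
  then have "exp (s - s1) * norm (\<beta> (s1 + h) - \<beta> s1) \<le> norm (\<beta> (s + h) - \<beta> s)"
    by (simp add: mult.assoc[symmetric] exp_add[symmetric])
  moreover have "exp (s - s1) * ((?d - \<epsilon>/2) * h) \<le> exp (s - s1) * norm (\<beta> (s1 + h) - \<beta> s1)"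
    using h by (intro mult_left_mono) auto
  moreover have "norm (\<beta> (s + h) - \<beta> s) \<le> norm (h *\<^sub>R w) + \<epsilon>/2 * h"
    using norm_triangle_ineq[of "h *\<^sub>R w" "\<beta> (s + h) - \<beta> s - h *\<^sub>R w"] h by simp
  \<comment> \<open>The factor is at most 1, so the error made at \<open>s1\<close> is not amplified
    and the two halves add up to at most \<open>\<epsilon>\<close>.\<close>
  moreover have "exp (s - s1) * (\<epsilon>/2 * h) \<le> 1 * (\<epsilon>/2 * h)"
    using s \<epsilon> h by (intro mult_right_mono) auto
  ultimately have "h * (?d * exp (s - s1)) \<le> h * (norm w + \<epsilon>)"
    using h by (simp add: algebra_simps)
  then show "?d * exp (s - s1) \<le> norm w + \<epsilon>" using h by simp
qed

text \<open>The squared distance grows at least at rate twice the squared speed, which by the speed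
  bound is at least the growth rate of \<open>E\<close>. The two agree at \<open>s1\<close>, so
  before \<open>s1\<close> the squared distance is at most \<open>E\<close>.\<close>

lemma dist_upper_bound:
  assumes s: "0 \<le> s" "s \<le> s1"
  shows "infdist (\<beta> s) C \<le> infdist (\<beta> s1) C * exp (s - s1)"
proof -
  let ?d = "infdist (\<beta> s1) C"
  define E where "E t = ?d\<^sup>2 * exp (2 * t + (- 2 * s1))" for t
  define f where "f t = infdist (\<beta> t) C \<bullet> infdist (\<beta> t) C - E t" for t
  have sub: "{s..s1} \<subseteq> {0..B}" using s s1 by auto
  obtain K where "K-lipschitz_on {s..s1} f"
  proof -
    have "(1 * L)-lipschitz_on {s..s1} (\<lambda>t. infdist (\<beta> t) C)"
      by (rule lipschitz_on_compose2[OF lipschitz_on_subset[OF lip sub]])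
         (auto intro!: lipschitz_onI simp: dist_real_def infdist_triangle_abs)
    then obtain K1 where K1: "K1-lipschitz_on {s..s1} (\<lambda>t. infdist (\<beta> t) C \<bullet> infdist (\<beta> t) C)"
      using lipschitz_on_inner_compact[OF compact_Icc] by blast
    obtain K2 where "K2-lipschitz_on {s..s1} E"
      using lipschitz_on_exp_affine[of s s1 2 "- 2 * s1"] lipschitz_on_cmult_real unfolding E_def by blast
    then show thesis using K1 that lipschitz_on_diff unfolding f_def by blast
  qed
  then have "f s \<le> f s1"
  proof (rule lipschitz_nondecreasing_ae[OF s(2) _ negl])
    fix t assume t: "t \<in> {s<..<s1} - N"
    then obtain w where w: "(\<beta> has_vector_derivative w) (at t)" "sqdist_supergradient C (\<beta> t) w"
      using flow[of t] s s1 by auto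
    define g where "g u = \<beta> u - \<beta> t" for u
    have g': "(g has_vector_derivative w) (at t)"
      unfolding g_def using w(1) by (auto intro!: derivative_eq_intros)
    \<comment> \<open>The distance along the arc need not be differentiable at \<open>t\<close>; the supergradient inequality
      bounds it from above by a function that is.\<close>
    define k where "k u = 2 * (w \<bullet> g u) + g u \<bullet> g u - E u" for u
    have "((\<lambda>u. w \<bullet> g u) has_real_derivative w \<bullet> w) (at t)"
      using bounded_linear.has_vector_derivative[OF bounded_linear_inner_right g']
      by (simp add: has_real_derivative_iff_has_vector_derivative)
    moreover have "((\<lambda>u. g u \<bullet> g u) has_real_derivative g t \<bullet> w + w \<bullet> g t) (at t)"
      unfolding has_real_derivative_iff_has_vector_derivative
      by (rule bounded_bilinear.has_vector_derivative[OF bounded_bilinear_inner g' g'])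
    ultimately have "(k has_real_derivative 2 * (w \<bullet> w) - 2 * E t) (at t)"
      unfolding k_def E_def by (auto intro!: derivative_eq_intros simp: g_def)
    moreover have "E t \<le> w \<bullet> w"
    proof -
      have "(?d * exp (t - s1))\<^sup>2 \<le> (norm w)\<^sup>2"
        using t s by (intro power_mono speed_lower_bound w) (auto simp: infdist_nonneg)
      then show ?thesis
        by (simp add: E_def dot_square_norm power_mult_distrib exp_double[symmetric] algebra_simps)
    qed
    moreover have "k t - k u \<le> f t - f u" for u
    proof -
      have "(infdist (\<beta> u) C)\<^sup>2 \<le> (infdist (\<beta> t) C)\<^sup>2 + 2 * (w \<bullet> (\<beta> u - \<beta> t)) + (norm (\<beta> u - \<beta> t))\<^sup>2"
        using w(2) unfolding sqdist_supergradient_def by blast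
      then show ?thesis
        unfolding f_def k_def g_def by (simp add: dot_square_norm power2_eq_square[of "infdist _ _"])
    qed
    ultimately show "\<exists>k D. (k has_real_derivative D) (at t) \<and> 0 \<le> D \<and> (\<forall>u\<in>{s..<t}. k t - k u \<le> f t - f u)"
      by (intro exI[of _ k] exI[of _ "2 * (w \<bullet> w) - 2 * E t"]) auto
  qed
  then have "(infdist (\<beta> s) C)\<^sup>2 \<le> (?d * exp (s - s1))\<^sup>2"
    by (simp add: f_def E_def power_mult_distrib exp_double[symmetric] power2_eq_square[of "infdist _ _"] algebra_simps)
  then show ?thesis by (rule power2_le_imp_le) (simp add: infdist_nonneg)
qed

text \<open>The speed is at most the distance, hence at most
  \<open>infdist (\<beta> s1) C * exp (t - s1)\<close>. Integrating gives the displacement bound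
  \<open>infdist (\<beta> s1) C * (1 - exp (- s1))\<close>, and the bound on the distance at time 0
  turns this into the gain in distance.\<close>

lemma displacement_le: "norm (\<beta> s1 - \<beta> 0) \<le> infdist (\<beta> s1) C - infdist (\<beta> 0) C"
proof -
  let ?d = "infdist (\<beta> s1) C"
  \<comment> \<open>Projecting on the direction of the total displacement makes the estimate scalar.
    If the displacement vanishes, \<open>e\<close> is 0, so only \<open>norm e \<le> 1\<close> is
    claimed.\<close>
  define e where "e = sgn (\<beta> s1 - \<beta> 0)"
  have e: "norm e \<le> 1" by (simp add: e_def norm_sgn)
  define f where "f t = ?d * exp (1 * t + (- s1)) - e \<bullet> \<beta> t" for t
  obtain K where "K-lipschitz_on {0..s1} f"
  proof -
    obtain K where "K-lipschitz_on {0..s1} (\<lambda>t. e \<bullet> \<beta> t)"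
      using lipschitz_on_inner_compact[OF compact_Icc lipschitz_on_constant lipschitz_on_subset[OF lip]] s1
      by (metis atLeastatMost_subset_iff less_imp_le order_refl)
    moreover obtain K2 where "K2-lipschitz_on {0..s1} (\<lambda>t. ?d * exp (1 * t + (- s1)))"
      using lipschitz_on_exp_affine[of 0 s1 1 "- s1"] lipschitz_on_cmult_real by blast
    ultimately show thesis using that lipschitz_on_diff unfolding f_def by blast
  qed
  then have "f 0 \<le> f s1"
  proof (rule lipschitz_nondecreasing_ae[OF _ _ negl, rotated])
    fix t assume t: "t \<in> {0<..<s1} - N"
    then obtain w where w: "(\<beta> has_vector_derivative w) (at t)" "sqdist_supergradient C (\<beta> t) w"
      using flow[of t] s1 by auto
    have "((\<lambda>t. e \<bullet> \<beta> t) has_real_derivative e \<bullet> w) (at t)"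
      using bounded_linear.has_vector_derivative[OF bounded_linear_inner_right w(1)]
      by (simp add: has_real_derivative_iff_has_vector_derivative)
    then have "(f has_real_derivative ?d * exp (t - s1) - e \<bullet> w) (at t)"
      unfolding f_def by (auto intro!: derivative_eq_intros)
    moreover have "e \<bullet> w \<le> ?d * exp (t - s1)"
    proof -
      have "e \<bullet> w \<le> norm e * norm w" by (rule norm_cauchy_schwarz)
      also have "\<dots> \<le> norm w" using e by (simp add: mult_left_le_one_le)
      also have "\<dots> \<le> infdist (\<beta> t) C"
        using t s1 by (intro sqdist_supergradient_norm_le w pos) auto
      also have "\<dots> \<le> ?d * exp (t - s1)" using t by (intro dist_upper_bound) auto
      finally show ?thesis .
    qed
    ultimately show "\<exists>k D. (k has_real_derivative D) (at t) \<and> 0 \<le> D \<and> (\<forall>u\<in>{0..<t}. k t - k u \<le> f t - f u)"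
      by (intro exI[of _ f] exI) auto
  qed (use s1 in simp)
  then have "e \<bullet> (\<beta> s1 - \<beta> 0) \<le> ?d - ?d * exp (- s1)"
    unfolding f_def by (simp add: inner_diff_right)
  moreover have "e \<bullet> (\<beta> s1 - \<beta> 0) = norm (\<beta> s1 - \<beta> 0)"
    by (cases "\<beta> s1 = \<beta> 0") (simp_all add: e_def sgn_div_norm dot_square_norm power2_eq_square)
  ultimately show ?thesis using dist_upper_bound[of 0] s1 by simp
qed

text \<open>The point \<open>\<beta> s1\<close> serves as the far end of the segment; it differs
  from \<open>\<beta> 0\<close> because the distance has strictly increased.\<close>

lemma differentiable_at_start: "(\<lambda>y. infdist y C) differentiable (at (\<beta> 0))"
proof -
  obtain c where c: "c \<in> C" "infdist (\<beta> 0) C = norm (\<beta> 0 - c)"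
    using infdist_attained[OF closed nonempty] by (metis dist_norm)
  have "infdist (\<beta> s1) C * exp (- s1) < infdist (\<beta> s1) C * 1"
    using pos[of s1] s1 by (intro mult_strict_left_mono) auto
  then have "infdist (\<beta> 0) C < infdist (\<beta> s1) C"
    using dist_upper_bound[of 0] s1 by simp
  then have "\<beta> s1 \<noteq> \<beta> 0" by auto
  then show ?thesis
    using displacement_le pos[of 0] s1
    by (intro differentiable_infdist_interior_segment[OF c]) auto
qed

end

end

section \<open>The change of time\<close>

text \<open>\<open>S\<close> is the integral of \<open>1 / \<delta>\<close> and \<open>T\<close> its
  inverse, so \<open>T\<close> solves \<open>T' = \<delta>(T)\<close>. Differentiability of
  \<open>S\<close> serves to carry null sets to null sets; the Lipschitz bound for \<open>T\<close>
  keeps the reparametrised arc Lipschitz.\<close>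

lemma time_change:
  fixes a b :: real and \<delta> :: "real \<Rightarrow> real"
  assumes "a < b" and cont: "continuous_on {a..b} \<delta>" and pos: "\<And>t. t \<in> {a..b} \<Longrightarrow> 0 < \<delta> t"
  obtains S T :: "real \<Rightarrow> real" and K where
    "S a = 0" "strict_mono_on {a..b} S" "S differentiable_on {a..b}"
    "T ` {0..S b} \<subseteq> {a..b}" "K-lipschitz_on {0..S b} T"
    "\<forall>t\<in>{a..b}. T (S t) = t" "\<forall>s\<in>{0..S b}. S (T s) = s"
    "\<forall>s\<in>{0<..<S b}. T s \<in> {a<..<b}"
    "\<forall>s\<in>{0<..<S b}. (T has_real_derivative \<delta> (T s)) (at s)"
proof -
  define S where "S t = integral {a..t} (\<lambda>r. inverse (\<delta> r))" for t
  have nz: "\<delta> t \<noteq> 0" if "t \<in> {a..b}" for t using pos[OF that] by simp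
  have derS: "(S has_real_derivative inverse (\<delta> t)) (at t within {a..b})" if "t \<in> {a..b}" for t
    unfolding S_def using that by (intro integral_has_real_derivative continuous_intros cont) (auto simp: nz)
  have Sa: "S a = 0" by (simp add: S_def)
  obtain K where K: "K > 0" "\<And>t. t \<in> {a..b} \<Longrightarrow> \<delta> t \<le> K"
  proof -
    have "bounded (\<delta> ` {a..b})" using cont by (intro compact_imp_bounded compact_continuous_image) auto
    then obtain K where "K > 0" "\<And>t. t \<in> {a..b} \<Longrightarrow> \<bar>\<delta> t\<bar> \<le> K"
      unfolding bounded_pos by (metis imageI real_norm_def)
    then show thesis using that by fastforce
  qed
  \<comment> \<open>By the mean value theorem, as \<open>S\<close> has slope at least
    \<open>1 / K\<close>. This yields both strict monotonicity of \<open>S\<close> and the Lipschitz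
    bound for its inverse.\<close>
  have grow: "t' - t \<le> K * (S t' - S t)" if tt: "a \<le> t" "t < t'" "t' \<le> b" for t t'
  proof -
    have "\<exists>\<xi>\<in>{t<..<t'}. S t' - S t = (\<lambda>h. inverse (\<delta> \<xi>) * h) (t' - t)"
    proof (rule mvt_simple[OF tt(2)])
      fix x assume x: "t \<le> x" "x \<le> t'"
      then have "(S has_derivative (\<lambda>h. inverse (\<delta> x) * h)) (at x within {a..b})"
        using derS[of x] tt unfolding has_field_derivative_def by auto
      then show "(S has_derivative (\<lambda>h. inverse (\<delta> x) * h)) (at x within {t..t'})"
        by (rule has_derivative_subset) (use tt in auto)
    qed
    then obtain \<xi> where \<xi>: "\<xi> \<in> {t<..<t'}" "S t' - S t = inverse (\<delta> \<xi>) * (t' - t)" by auto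
    have "t' - t = \<delta> \<xi> * (S t' - S t)" using nz[of \<xi>] \<xi>(1) tt by (simp add: \<xi>(2))
    moreover have "0 < \<delta> \<xi>" "\<delta> \<xi> \<le> K" using \<xi> tt pos K by auto
    moreover have "0 \<le> S t' - S t" using \<xi>(2) tt \<open>0 < \<delta> \<xi>\<close> by simp
    ultimately show ?thesis using mult_right_mono by metis
  qed
  have smono: "strict_mono_on {a..b} S"
  proof (rule strict_mono_onI)
    fix t t' assume "t \<in> {a..b}" "t' \<in> {a..b}" "t < t'"
    then have "0 < K * (S t' - S t)" using grow[of t t'] by auto
    then show "S t < S t'" using K(1) by (simp add: zero_less_mult_iff)
  qed
  have inj: "inj_on S {a..b}" using smono by (rule strict_mono_on_imp_inj_on)
  have diffS: "S differentiable_on {a..b}"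
    using derS unfolding differentiable_on_def differentiable_def has_field_derivative_def by blast
  then have contS: "continuous_on {a..b} S" by (rule differentiable_imp_continuous_on)
  have le: "S t \<le> S t' \<longleftrightarrow> t \<le> t'" if "t \<in> {a..b}" "t' \<in> {a..b}" for t t'
    using strict_mono_on_leD[OF smono] strict_mono_onD[OF smono] that by (metis linorder_not_le order_less_imp_le)
  have img: "S ` {a..b} = {0..S b}"
  proof
    show "S ` {a..b} \<subseteq> {0..S b}" using le[of a] le[of _ b] \<open>a < b\<close> by (auto simp: Sa)
    show "{0..S b} \<subseteq> S ` {a..b}"
      using IVT'[of S a _ b] contS \<open>a < b\<close> by (force simp: Sa)
  qed
  define T where "T = inv_into {a..b} S"
  have TS: "T (S t) = t" if "t \<in> {a..b}" for t unfolding T_def using inv_into_f_f[OF inj that] .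
  have ST: "S (T s) = s" if "s \<in> {0..S b}" for s unfolding T_def by (rule f_inv_into_f[OF that[folded img]])
  have Tin: "T s \<in> {a..b}" if "s \<in> {0..S b}" for s unfolding T_def by (rule inv_into_into[OF that[folded img]])
  have lipT: "K-lipschitz_on {0..S b} T"
  proof (rule lipschitz_on_leI)
    fix s s' assume s: "s \<in> {0..S b}" "s' \<in> {0..S b}" "s \<le> s'"
    have S_T: "S (T s) = s" "S (T s') = s'" using ST s by auto
    have le_T: "T s \<le> T s'" using le[OF Tin[OF s(1)] Tin[OF s(2)]] S_T s(3) by simp
    have "T s' - T s \<le> K * (s' - s)"
    proof (cases "T s = T s'")
      case True
      then show ?thesis using K(1) s(3) by simp
    next
      case False
      then show ?thesis using grow[of "T s" "T s'"] Tin[OF s(1)] Tin[OF s(2)] le_T S_T by simp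
    qed
    then show "dist (T s) (T s') \<le> K * dist s s'" using le_T s(3) by (simp add: dist_real_def)
  qed (use K in simp)
  have Tin': "T s \<in> {a<..<b}" if "s \<in> {0<..<S b}" for s
    using Tin[of s] ST[of s] that Sa by (auto simp: less_le)
  have "(T has_real_derivative \<delta> (T s)) (at s)" if s: "s \<in> {0<..<S b}" for s
  proof -
    have "(T has_real_derivative inverse (inverse (\<delta> (T s)))) (at s)"
    proof (rule DERIV_inverse_function)
      show "(S has_real_derivative inverse (\<delta> (T s))) (at (T s))"
        using derS[of "T s"] Tin'[OF s] at_within_Icc_at[of a "T s" b] by simp
      show "inverse (\<delta> (T s)) \<noteq> 0" using nz Tin[of s] s by simp
      show "isCont T s"
        using lipschitz_on_continuous_on[OF lipT] s by (simp add: continuous_on_interior)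
    qed (use s ST in auto)
    then show ?thesis by simp
  qed
  then show thesis
    using that[of S T K] Sa smono diffS lipT TS ST Tin Tin' by blast
qed

section \<open>Propagation of singularities along the arc\<close>

theorem theorem3p7:
  fixes \<Omega> :: "(real ^ 'n) set" and x :: "real ^ 'n" and \<gamma> :: "real \<Rightarrow> real ^ 'n" and t\<^sub>0 :: real
  assumes "open \<Omega>"
    and "frontier \<Omega> \<noteq> {}"
    and "x \<in> \<Omega>"
    and "\<gamma> ` {0..} \<subseteq> \<Omega>"
    and "\<exists>L. L-lipschitz_on {0..} \<gamma>"
    and "AE t in lebesgue_on {0..}.
           \<exists>v \<in> superdifferential \<Omega> (boundary_dist \<Omega>) (\<gamma> t).
             (\<gamma> has_vector_derivative v) (at t within {0..})"
    and "\<gamma> 0 = x"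
    and "t\<^sub>0 \<ge> 0"
    and "\<gamma> t\<^sub>0 \<in> singular_set \<Omega>"
  shows "\<forall>t \<in> {t\<^sub>0..}. \<gamma> t \<in> singular_set \<Omega>"
proof (rule ballI, rule ccontr)
  fix t1 assume t1: "t1 \<in> {t\<^sub>0..}" "\<gamma> t1 \<notin> singular_set \<Omega>"
  have in\<Omega>: "\<gamma> t \<in> \<Omega>" if "0 \<le> t" for t using assms(4) that by auto
  have bd: "boundary_dist \<Omega> = (\<lambda>y. infdist y (frontier \<Omega>))" by (auto simp: boundary_dist_def)
  have diff: "(\<lambda>y. infdist y (frontier \<Omega>)) differentiable (at (\<gamma> t1))"
    using t1 in\<Omega>[of t1] \<open>t\<^sub>0 \<ge> 0\<close> by (auto simp: singular_set_def bd)
  have less: "t\<^sub>0 < t1" using t1 assms(9) by (auto simp: less_le)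
  obtain L where L: "L-lipschitz_on {0..} \<gamma>" using assms(5) by blast
  \<comment> \<open>The extra unit after \<open>t1\<close> leaves room for forward increments
    starting at \<open>t1\<close>.\<close>
  define a b where "a = t\<^sub>0" and "b = t1 + 1"
  have ab: "0 \<le> a" "a < b" "a < t1" "t1 < b" using less assms(8) by (auto simp: a_def b_def)
  have pos: "0 < infdist (\<gamma> t) (frontier \<Omega>)" if "0 \<le> t" for t
  proof (rule infdist_pos_not_in_closed)
    show "\<gamma> t \<notin> frontier \<Omega>" using in\<Omega>[OF that] assms(1) by (simp add: frontier_def interior_open)
  qed (use assms in auto)
  obtain N where N: "negligible N"
    "\<And>t. t \<in> {0..} - N \<Longrightarrow> \<exists>v\<in>superdifferential \<Omega> (boundary_dist \<Omega>) (\<gamma> t).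
      (\<gamma> has_vector_derivative v) (at t within {0..})"
  proof -
    obtain N where "N \<in> null_sets (lebesgue_on {0..})"
      and sub: "{t \<in> space (lebesgue_on {0..}). \<not> (\<exists>v\<in>superdifferential \<Omega> (boundary_dist \<Omega>) (\<gamma> t).
      (\<gamma> has_vector_derivative v) (at t within {0..}))} \<subseteq> N"
      using assms(6) unfolding eventually_ae_filter by blast
    then have "N \<in> null_sets lebesgue" by (simp add: null_sets_restrict_space)
    then show thesis using that[of N] sub by (auto simp: negligible_iff_null_sets)
  qed
  let ?\<delta> = "\<lambda>t. infdist (\<gamma> t) (frontier \<Omega>)"
  have cont: "continuous_on {a..b} ?\<delta>"
    by (intro continuous_intros continuous_on_subset[OF lipschitz_on_continuous_on[OF L]]) (use ab in auto)
  have pos': "0 < ?\<delta> t" if "t \<in> {a..b}" for t using pos[of t] that ab by simp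
  obtain S T K where S: "S a = 0" "strict_mono_on {a..b} S" "S differentiable_on {a..b}"
    and T: "T ` {0..S b} \<subseteq> {a..b}" "K-lipschitz_on {0..S b} T"
      "\<forall>t\<in>{a..b}. T (S t) = t" "\<forall>s\<in>{0..S b}. S (T s) = s"
      "\<forall>s\<in>{0<..<S b}. T s \<in> {a<..<b}"
      "\<forall>s\<in>{0<..<S b}. (T has_real_derivative ?\<delta> (T s)) (at s)"
    using time_change[OF ab(2) cont pos'] by metis
  \<comment> \<open>The exceptional new times are the image under \<open>S\<close> of the old ones.
    At all other interior times the chain rule multiplies the velocity by the distance, giving a
    supergradient of half the squared distance.\<close>
  interpret sqdist_flow "frontier \<Omega>" "\<gamma> \<circ> T" "S b" "L * K" "S ` (N \<inter> {a..b})"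
  proof
    show "negligible (S ` (N \<inter> {a..b}))"
    proof (rule negligible_differentiable_image_negligible[OF order_refl])
      show "negligible (N \<inter> {a..b})" by (rule negligible_Int) (simp add: N(1))
      show "S differentiable_on N \<inter> {a..b}" by (rule differentiable_on_subset[OF S(3)]) auto
    qed
    show "(L * K)-lipschitz_on {0..S b} (\<gamma> \<circ> T)"
      by (rule lipschitz_on_compose[OF T(2) lipschitz_on_subset[OF L]], rule order_trans[OF T(1)])
         (use ab in auto)
    show "0 < infdist ((\<gamma> \<circ> T) s) (frontier \<Omega>)" if "s \<in> {0..S b}" for s
      using pos[of "T s"] T(1) that ab by force
    fix s assume s: "s \<in> {0<..<S b} - S ` (N \<inter> {a..b})"
    then have Ts: "T s \<in> {a<..<b}" using T(5) by simp
    have "T s \<notin> N"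
    proof
      assume "T s \<in> N"
      then have "S (T s) \<in> S ` (N \<inter> {a..b})" using Ts by auto
      then show False using s T(4) by auto
    qed
    then obtain v where v: "v \<in> superdifferential \<Omega> (boundary_dist \<Omega>) (\<gamma> (T s))"
        "(\<gamma> has_vector_derivative v) (at (T s) within {0..})"
      using N(2)[of "T s"] Ts ab by auto
    \<comment> \<open>Since \<open>T s > a\<close> and \<open>a \<ge> 0\<close>, the time
      \<open>T s\<close> is interior to the half-line and the derivative is two-sided.\<close>
    have "(\<gamma> has_vector_derivative v) (at (T s))"
      using v(2) Ts ab at_within_interior[of "T s" "{0..}"] by simp
    then have "(\<gamma> \<circ> T has_vector_derivative ?\<delta> (T s) *\<^sub>R v) (at s)"
      using T(6) s by (intro vector_diff_chain_at) (auto simp: has_real_derivative_iff_has_vector_derivative)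
    moreover have "sqdist_supergradient (frontier \<Omega>) (\<gamma> (T s)) (?\<delta> (T s) *\<^sub>R v)"
      using superdifferential_sqdist[OF assms(1,2) in\<Omega> v(1)] Ts ab by (simp add: boundary_dist_def)
    ultimately show "\<exists>w. (\<gamma> \<circ> T has_vector_derivative w) (at s) \<and>
        sqdist_supergradient (frontier \<Omega>) ((\<gamma> \<circ> T) s) w" by auto
  qed (use assms in auto)
  have "(\<lambda>y. infdist y (frontier \<Omega>)) differentiable (at ((\<gamma> \<circ> T) 0))"
  proof (rule differentiable_at_start[of "S t1"])
    show "0 < S t1" "S t1 < S b"
      using strict_mono_onD[OF S(2), of a t1] strict_mono_onD[OF S(2), of t1 b] S(1) ab by auto
  qed (use diff T(3) ab in auto)
  moreover have "T 0 = a" using T(3) S(1) ab by (metis atLeastAtMost_iff less_imp_le order_refl)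
  ultimately have "(\<lambda>y. infdist y (frontier \<Omega>)) differentiable (at (\<gamma> t\<^sub>0))"
    using \<open>T 0 = a\<close> by (simp add: a_def)
  then show False using assms(9) by (simp add: singular_set_def bd)
qed

end
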